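(* Let $K$ be a countable (infinite) field, let $(\Omega,\mathcal{B},\mu)$ be a probability space and let $(T_g)_{g\in\mathcal{A}_K}$ be a measure preserving action of $\mathcal{A}_K$ on $\Omega$. Let $(F_N)$ be a double F\o lner sequence in $K$. Then for each $B\in\mathcal{B}$ the limit $$\lim_{N\to\infty}\frac1{|F_N|}\sum_{u\in F_N\setminus\{0\}}\mu\big(A_{-u}B\cap M_{1/u}B\big)$$ exists and is at least $\mu(B)^2$.
   Context: $\mathcal{A}_K$ is the affine group of $K$: the group of maps $x\mapsto ux+v$ ($u\in K^*=K\setminus\{0\}$, $v\in K$) under composition. For $u\in K^*$, $A_{-u}B:=T_gB$ where $g(x)=x-u$, and $M_{1/u}B:=T_hB$ where $h(x)=x/u$. A double F\o lner sequence in $K$ is a sequence $(F_N)$ of non-empty finite subsets of $K$ such that for each $x\in K^*$, $\lim_N|F_N\cap(F_N+x)|/|F_N|=\lim_N|F_N\cap(xF_N)|/|F_N|=1$. *)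

theory Defs
  imports "HOL-Probability.Probability" "HOL-Algebra.Group_Action"
begin

definition affine_group :: "('k::field \<Rightarrow> 'k) monoid" where
  "affine_group =
    \<lparr>carrier = {g. \<exists>u v. u \<noteq> 0 \<and> g = (\<lambda>x. u * x + v)},
     mult = (\<circ>),
     one = id\<rparr>"

lemma affine_groupI: "u \<noteq> 0 \<Longrightarrow> (\<lambda>x. u * x + v) \<in> carrier affine_group"
  unfolding affine_group_def by auto

lemma group_affine_group: "group (affine_group :: ('k::field \<Rightarrow> 'k) monoid)"
proof (rule groupI)
  fix f g :: "'k \<Rightarrow> 'k"
  assume "f \<in> carrier affine_group" "g \<in> carrier affine_group"
  then obtain a b c d where "a \<noteq> 0" "f = (\<lambda>x. a * x + b)" "c \<noteq> 0" "g = (\<lambda>x. c * x + d)"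
    by (auto simp: affine_group_def)
  then have "a * c \<noteq> 0" "f \<circ> g = (\<lambda>x. (a * c) * x + (a * d + b))"
    by (auto simp: fun_eq_iff algebra_simps)
  then show "f \<otimes>\<^bsub>affine_group\<^esub> g \<in> carrier affine_group"
    using affine_groupI[of "a * c" "a * d + b"] by (simp add: affine_group_def)
next
  show "\<one>\<^bsub>affine_group\<^esub> \<in> carrier (affine_group :: ('k \<Rightarrow> 'k) monoid)"
    using affine_groupI[of "1 :: 'k" 0] by (simp add: affine_group_def id_def)
next
  fix f :: "'k \<Rightarrow> 'k"
  assume "f \<in> carrier affine_group"
  then obtain a b where ab: "a \<noteq> 0" "f = (\<lambda>x. a * x + b)"
    by (auto simp: affine_group_def)
  have "(\<lambda>x. inverse a * x + (- (inverse a * b))) \<in> carrier affine_group"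
    using ab by (intro affine_groupI) simp
  moreover have "(\<lambda>x. inverse a * x + (- (inverse a * b))) \<otimes>\<^bsub>affine_group\<^esub> f = \<one>\<^bsub>affine_group\<^esub>"
    using ab by (auto simp: affine_group_def fun_eq_iff field_simps)
  ultimately show "\<exists>g \<in> carrier affine_group. g \<otimes>\<^bsub>affine_group\<^esub> f = \<one>\<^bsub>affine_group\<^esub>"
    by blast
qed (auto simp: affine_group_def o_assoc)

text \<open>The maps \<open>T g\<close> form a genuine (pointwise, not almost everywhere) left action by bijections
  of \<open>space M\<close>. Following \<^locale>\<open>group_action\<close>, each \<open>T g\<close> is normalised to be
  \<open>undefined\<close> outside \<open>space M\<close>; this does not affect images of subsets of \<open>space M\<close>.\<close>

definition measure_preserving_action ::
    "('g, 'm) monoid_scheme \<Rightarrow> 'w measure \<Rightarrow> ('g \<Rightarrow> 'w \<Rightarrow> 'w) \<Rightarrow> bool" where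
  "measure_preserving_action G M T \<longleftrightarrow>
     group_action G (space M) T \<and>
     (\<forall>g \<in> carrier G. T g \<in> measurable M M \<and>
        (\<forall>B \<in> sets M. emeasure M (T g -` B \<inter> space M) = emeasure M B))"

definition double_Folner_sequence :: "(nat \<Rightarrow> 'k::field set) \<Rightarrow> bool" where
  "double_Folner_sequence F \<longleftrightarrow>
     (\<forall>N. finite (F N) \<and> F N \<noteq> {}) \<and>
     (\<forall>x. x \<noteq> 0 \<longrightarrow>
        (\<lambda>N. real (card (F N \<inter> (\<lambda>y. y + x) ` F N)) / real (card (F N))) \<longlonglongrightarrow> 1 \<and>
        (\<lambda>N. real (card (F N \<inter> (\<lambda>y. x * y) ` F N)) / real (card (F N))) \<longlonglongrightarrow> 1)"

definition shift_set :: "(('k::field \<Rightarrow> 'k) \<Rightarrow> 'w \<Rightarrow> 'w) \<Rightarrow> 'k \<Rightarrow> 'w set \<Rightarrow> 'w set" where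
  "shift_set T v B = T (\<lambda>x. x + v) ` B"

definition dilate_set :: "(('k::field \<Rightarrow> 'k) \<Rightarrow> 'w \<Rightarrow> 'w) \<Rightarrow> 'k \<Rightarrow> 'w set \<Rightarrow> 'w set" where
  "dilate_set T u B = T (\<lambda>x. u * x) ` B"

end

theory Submission
  imports Defs
begin

text \<open>
  Write \<open>f\<close> for the indicator of \<open>B\<close>. After a dilation, the sum becomes the average over \<open>u\<close> of
  \<open>\<integral> f (T\<^sub>u w) f w\<close>, where \<open>T\<^sub>u\<close> is the action of \<open>x \<mapsto> x / u + u\<close>. Instead of projecting onto invariant
  functions, which requires the completeness of \<open>L\<^sup>2\<close>, take an almost shift invariant average \<open>h\<close> of
  shifts of \<open>f\<close> and an almost dilation invariant average \<open>k\<close> of dilations of \<open>h\<close>; they exist by the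
  parallelogram law. The contribution of \<open>f - h\<close> vanishes by van der Corput's trick over the multiplicative
  group, that of \<open>h\<close> is nearly \<open>\<integral> k f\<close>. Since shifts are normalised by dilations, \<open>k\<close> is also almost
  shift invariant, and so \<open>\<integral> k f\<close> is nearly \<open>\<integral> k h\<close>, hence nearly \<open>\<integral> k\<^sup>2\<close>, which is at least
  \<open>(\<integral> k)\<^sup>2 = \<mu>(B)\<^sup>2\<close>.
\<close>

section \<open>Averages along a double Folner sequence\<close>

text \<open>Division by zero gives the value \<open>0\<close> over an empty or infinite set, so in
  \<open>avg_const_le\<close> a constant averages to itself only up to an inequality.\<close>

definition avg :: "'k set \<Rightarrow> ('k \<Rightarrow> real) \<Rightarrow> real" where
  "avg A \<phi> = (\<Sum>u\<in>A. \<phi> u) / real (card A)"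

lemma avg_add: "avg A (\<lambda>u. \<phi> u + \<psi> u) = avg A \<phi> + avg A \<psi>"
  by (simp add: avg_def sum.distrib add_divide_distrib)

lemma avg_diff: "avg A (\<lambda>u. \<phi> u - \<psi> u) = avg A \<phi> - avg A \<psi>"
  by (simp add: avg_def sum_subtractf diff_divide_distrib)

lemma avg_cmult: "avg A (\<lambda>u. c * \<phi> u) = c * avg A \<phi>"
  by (simp add: avg_def sum_distrib_left[symmetric])

lemma avg_multc: "avg A (\<lambda>u. \<phi> u * c) = avg A \<phi> * c"
  by (simp add: avg_def sum_distrib_right[symmetric])

lemma avg_sum: "avg A (\<lambda>u. \<Sum>i\<in>I. \<phi> i u) = (\<Sum>i\<in>I. avg A (\<phi> i))"
  by (simp add: avg_def sum_divide_distrib[symmetric] sum.swap[of _ A])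

lemma avg_mono: "(\<And>u. u \<in> A \<Longrightarrow> \<phi> u \<le> \<psi> u) \<Longrightarrow> avg A \<phi> \<le> avg A \<psi>"
  by (simp add: avg_def divide_right_mono sum_mono)

lemma avg_abs_le: "\<bar>avg A \<phi>\<bar> \<le> avg A (\<lambda>u. \<bar>\<phi> u\<bar>)"
  by (simp add: avg_def abs_divide divide_right_mono)

lemma avg_const_le: "0 \<le> c \<Longrightarrow> avg A (\<lambda>u. c) \<le> c"
  by (cases "card A = 0") (auto simp: avg_def)

lemma avg_bounded:
  assumes "\<And>u. u \<in> A \<Longrightarrow> \<bar>\<phi> u\<bar> \<le> c" "0 \<le> c"
  shows "\<bar>avg A \<phi>\<bar> \<le> c"
  using avg_abs_le[of A \<phi>] avg_mono[of A "\<lambda>u. \<bar>\<phi> u\<bar>" "\<lambda>u. c"] avg_const_le[of c A] assms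
  by fastforce

lemma avg_square_le: "(avg A \<phi>)\<^sup>2 \<le> avg A (\<lambda>u. (\<phi> u)\<^sup>2)"
proof (cases "card A = 0")
  case False
  have "(\<Sum>u\<in>A. \<phi> u)\<^sup>2 \<le> (\<Sum>u\<in>A. (\<phi> u)\<^sup>2) * real (card A)"
    using Cauchy_Schwarz_ineq_sum[of \<phi> "\<lambda>_. 1" A] by simp
  then show ?thesis
    using False by (simp add: avg_def power_divide field_simps power2_eq_square)
qed (auto simp: avg_def)

lemma avg_cong: "(\<And>u. u \<in> A \<Longrightarrow> \<phi> u = \<psi> u) \<Longrightarrow> avg A \<phi> = avg A \<psi>"
  by (simp add: avg_def)

text \<open>The value \<open>0\<close> at \<open>u = 0\<close> stands in where \<open>1 / u\<close>
  gives no affine bijection. The price is the proportion of the point \<open>0\<close> in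
  \<open>A\<close>, which \<open>Folner_point\<close> makes small.\<close>

lemma avg_punctured:
  assumes "\<bar>\<phi> 0\<bar> \<le> 1"
  shows "\<bar>avg A \<phi> - avg A (\<lambda>u. if u = 0 then 0 else \<phi> u)\<bar> \<le> avg A (indicator {0})"
proof -
  have "\<bar>avg A \<phi> - avg A (\<lambda>u. if u = 0 then 0 else \<phi> u)\<bar>
      \<le> avg A (\<lambda>u. \<bar>\<phi> u - (if u = 0 then 0 else \<phi> u)\<bar>)"
    unfolding avg_diff[symmetric] by (rule avg_abs_le)
  also have "\<dots> \<le> avg A (indicator {0})"
    using assms by (intro avg_mono) auto
  finally show ?thesis .
qed

text \<open>Both sums run over \<open>C\<close>, the overlap of \<open>A\<close> with its image, so
  they differ only by what lies outside it. Each of the two remainders has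
  \<open>card A - card C\<close> terms.\<close>

lemma avg_inj_shift:
  assumes "finite A" "inj \<sigma>" "\<And>u. \<bar>\<phi> u\<bar> \<le> 1"
  shows "\<bar>avg A \<phi> - avg A (\<lambda>u. \<phi> (\<sigma> u))\<bar> \<le> 2 * (1 - real (card (A \<inter> \<sigma> ` A)) / real (card A))"
proof (cases "A = {}")
  case False
  define C where "C = A \<inter> \<sigma> ` A"
  have fin: "finite C" "finite (\<sigma> ` A)" "C \<subseteq> A" "C \<subseteq> \<sigma> ` A"
    using assms(1) by (auto simp: C_def)
  have cards: "real (card (A - C)) = real (card A) - real (card C)"
    "real (card (\<sigma> ` A - C)) = real (card A) - real (card C)"
    using fin assms(1) card_image[OF inj_on_subset[OF assms(2)], of A]
    by (simp_all add: card_Diff_subset of_nat_diff card_mono)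
  have "(\<Sum>u\<in>A. \<phi> (\<sigma> u)) = sum \<phi> (\<sigma> ` A)"
    using assms(2) by (simp add: sum.reindex inj_on_def)
  then have "(\<Sum>u\<in>A. \<phi> u) - (\<Sum>u\<in>A. \<phi> (\<sigma> u)) = sum \<phi> (A - C) - sum \<phi> (\<sigma> ` A - C)"
    using fin assms(1) by (simp add: sum_diff)
  also have "\<bar>\<dots>\<bar> \<le> \<bar>sum \<phi> (A - C)\<bar> + \<bar>sum \<phi> (\<sigma> ` A - C)\<bar>"
    by simp
  also have "\<dots> \<le> real (card (A - C)) * 1 + real (card (\<sigma> ` A - C)) * 1"
    using assms(3) by (intro add_mono order_trans[OF sum_abs] sum_bounded_above) auto
  finally have "\<bar>(\<Sum>u\<in>A. \<phi> u) - (\<Sum>u\<in>A. \<phi> (\<sigma> u))\<bar> \<le> 2 * (real (card A) - real (card C))"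
    using cards by simp
  moreover have "real (card A) > 0"
    using False assms(1) by (simp add: card_gt_0_iff)
  ultimately show ?thesis
    by (simp add: avg_def C_def[symmetric] diff_divide_distrib[symmetric] abs_divide field_simps)
qed (auto simp: avg_def)

text \<open>Quantifying \<open>\<phi>\<close> inside \<open>eventually\<close> gives one threshold
  for all of them. When \<open>\<phi>\<close> depends on a point \<open>w\<close>, the estimate is
  then uniform in \<open>w\<close>.\<close>

lemma Folner_inj_shift:
  assumes F: "double_Folner_sequence F" and "inj \<sigma>" "e > 0"
    and lim: "(\<lambda>N. real (card (F N \<inter> \<sigma> ` F N)) / real (card (F N))) \<longlonglongrightarrow> 1"
  shows "\<forall>\<^sub>F N in sequentially. \<forall>\<phi>. (\<forall>u. \<bar>\<phi> u\<bar> \<le> 1) \<longrightarrow>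
           \<bar>avg (F N) \<phi> - avg (F N) (\<lambda>u. \<phi> (\<sigma> u))\<bar> \<le> e"
proof -
  have fin: "finite (F N)" for N
    using F by (simp add: double_Folner_sequence_def)
  have "\<forall>\<^sub>F N in sequentially. 1 - e / 2 < real (card (F N \<inter> \<sigma> ` F N)) / real (card (F N))"
    by (rule order_tendstoD(1)[OF lim]) (use \<open>e > 0\<close> in simp)
  then show ?thesis
  proof eventually_elim
    case (elim N)
    show ?case
    proof (intro allI impI)
      fix \<phi> :: "'a \<Rightarrow> real"
      assume "\<forall>u. \<bar>\<phi> u\<bar> \<le> 1"
      then show "\<bar>avg (F N) \<phi> - avg (F N) (\<lambda>u. \<phi> (\<sigma> u))\<bar> \<le> e"
        using avg_inj_shift[OF fin \<open>inj \<sigma>\<close>, of \<phi> N] elim by simp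
    qed
  qed
qed

lemma Folner_add_shift:
  assumes F: "double_Folner_sequence F" and "e > 0"
  shows "\<forall>\<^sub>F N in sequentially. \<forall>\<phi>. (\<forall>u. \<bar>\<phi> u\<bar> \<le> 1) \<longrightarrow>
           \<bar>avg (F N) \<phi> - avg (F N) (\<lambda>u. \<phi> (u + x))\<bar> \<le> e"
proof (cases "x = 0")
  case False
  then show ?thesis
    using assms by (intro Folner_inj_shift) (auto simp: double_Folner_sequence_def inj_on_def)
qed (use assms in simp)

lemma Folner_mult_shift:
  assumes F: "double_Folner_sequence F" and "e > 0" "x \<noteq> 0"
  shows "\<forall>\<^sub>F N in sequentially. \<forall>\<phi>. (\<forall>u. \<bar>\<phi> u\<bar> \<le> 1) \<longrightarrow>
           \<bar>avg (F N) \<phi> - avg (F N) (\<lambda>u. \<phi> (x * u))\<bar> \<le> e"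
  using assms by (intro Folner_inj_shift) (auto simp: double_Folner_sequence_def inj_on_def)

text \<open>Translates of the indicator of \<open>0\<close> by \<open>m\<close> distinct nonzero
  elements have disjoint supports, so their averages add up to at most \<open>1\<close>, while each
  is eventually within \<open>e / 2\<close> of the average at \<open>0\<close>. An infinite field
  supplies such elements for every \<open>m\<close>.\<close>

lemma Folner_point:
  fixes F :: "nat \<Rightarrow> 'k::field set"
  assumes F: "double_Folner_sequence F" and inf: "infinite (UNIV :: 'k set)" and "e > 0"
  shows "\<forall>\<^sub>F N in sequentially. avg (F N) (indicator {0}) \<le> e"
proof -
  obtain m :: nat where m: "1 / real m < e / 2" "m > 0"
    using reals_Archimedean2[of "2 / e"] \<open>e > 0\<close>
    by (metis (no_types, opaque_lifting) divide_pos_pos inverse_divide less_imp_inverse_less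
        inverse_eq_divide of_nat_0_less_iff order_less_trans zero_less_numeral)
  obtain X :: "'k set" where X: "finite X" "card X = m" "X \<subseteq> - {0}"
    using infinite_arbitrarily_large[of "- {0 :: 'k}" m] inf
    by (metis Compl_eq_Diff_UNIV infinite_remove)
  have "\<forall>\<^sub>F N in sequentially. \<forall>x\<in>X. \<forall>\<phi>. (\<forall>u. \<bar>\<phi> u\<bar> \<le> 1) \<longrightarrow>
           \<bar>avg (F N) \<phi> - avg (F N) (\<lambda>u. \<phi> (u + x))\<bar> \<le> e / 2"
    using Folner_add_shift[OF F, of "e / 2"] X \<open>e > 0\<close> by (intro eventually_ball_finite) auto
  then show ?thesis
  proof eventually_elim
    case (elim N)
    let ?p = "indicator {0} :: 'k \<Rightarrow> real"
    have "avg (F N) ?p \<le> avg (F N) (\<lambda>u. ?p (u + x)) + e / 2" if "x \<in> X" for x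
    proof -
      have "\<forall>u. \<bar>?p u\<bar> \<le> 1"
        by (simp add: indicator_def)
      with elim that have "\<bar>avg (F N) ?p - avg (F N) (\<lambda>u. ?p (u + x))\<bar> \<le> e / 2"
        by blast
      then show ?thesis by linarith
    qed
    then have "(\<Sum>x\<in>X. avg (F N) ?p) \<le> (\<Sum>x\<in>X. avg (F N) (\<lambda>u. ?p (u + x)) + e / 2)"
      by (intro sum_mono)
    also have "\<dots> = avg (F N) (\<lambda>u. \<Sum>x\<in>X. ?p (u + x)) + m * e / 2"
      by (simp add: sum.distrib avg_sum X)
    also have "avg (F N) (\<lambda>u. \<Sum>x\<in>X. ?p (u + x)) \<le> 1"
    proof -
      have "(\<Sum>x\<in>X. ?p (u + x)) \<le> 1" for u
      proof -
        have "(\<Sum>x\<in>X. ?p (u + x)) = (\<Sum>x\<in>X. if x = - u then 1 else 0)"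
          by (intro sum.cong) (auto simp: indicator_def eq_neg_iff_add_eq_0 add.commute)
        also have "\<dots> \<le> 1"
          using X by simp
        finally show ?thesis .
      qed
      then have "avg (F N) (\<lambda>u. \<Sum>x\<in>X. ?p (u + x)) \<le> avg (F N) (\<lambda>u. 1)"
        by (intro avg_mono)
      then show ?thesis
        using avg_const_le[of 1 "F N"] by simp
    qed
    finally have "m * avg (F N) ?p \<le> 1 + m * e / 2"
      using X by simp
    then have "avg (F N) ?p \<le> 1 / m + e / 2"
      using m by (simp add: field_simps)
    then show ?case
      using m by simp
  qed
qed

text \<open>Squaring is at most two to one, so there are infinitely many nonzero squares; one root
  is chosen for each of \<open>m\<close> of them. Distinct squares make the shift parameter in
  \<open>van_der_Corput_correlation\<close> nonzero.\<close>

lemma distinct_squares: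
  assumes "infinite (UNIV :: 'k::field set)"
  obtains X :: "'k::field set" where "finite X" "card X = m" "0 \<notin> X" "inj_on (\<lambda>b. b * b) X"
proof -
  let ?s = "\<lambda>b :: 'k. b * b"
  have "infinite (?s ` (- {0}))"
  proof
    assume "finite (?s ` (- {0}))"
    then obtain a where "infinite {b \<in> - {0}. ?s b = ?s a}"
      using pigeonhole_infinite[of "- {0 :: 'k}" ?s] assms
      by (metis Compl_eq_Diff_UNIV infinite_remove)
    moreover have "{b \<in> - {0}. ?s b = ?s a} \<subseteq> {a, - a}"
      by (auto simp: square_eq_iff)
    ultimately show False
      by (meson finite.emptyI finite.insertI finite_subset)
  qed
  then obtain Y where Y: "finite Y" "card Y = m" "Y \<subseteq> ?s ` (- {0})"
    using infinite_arbitrarily_large by blast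
  then obtain X where X: "X \<subseteq> - {0}" "inj_on ?s X" "Y = ?s ` X"
    unfolding subset_image_inj by blast
  with Y have "finite X" "card X = m"
    by (auto simp: card_image finite_image_iff)
  with X that show thesis by auto
qed

section \<open>Bounded measurable functions\<close>

text \<open>The bound is required at every point of the type, so that it passes to
  \<open>h (t w)\<close> whatever \<open>t\<close> does outside \<open>space M\<close>. On a
  probability space such functions are integrable, and closure under products reduces integrability
  conditions to \<open>bm_intros\<close>.\<close>

definition bm :: "'w measure \<Rightarrow> ('w \<Rightarrow> real) set" where
  "bm M = {h \<in> borel_measurable M. \<exists>C. \<forall>w. \<bar>h w\<bar> \<le> C}"

lemma bmI: "h \<in> borel_measurable M \<Longrightarrow> (\<And>w. \<bar>h w\<bar> \<le> C) \<Longrightarrow> h \<in> bm M"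
  by (auto simp: bm_def)

lemma bm_add: "h \<in> bm M \<Longrightarrow> k \<in> bm M \<Longrightarrow> (\<lambda>w. h w + k w) \<in> bm M"
  by (auto simp: bm_def) (meson abs_triangle_ineq add_mono order_trans)

lemma bm_mult:
  assumes "h \<in> bm M" "k \<in> bm M"
  shows "(\<lambda>w. h w * k w) \<in> bm M"
proof -
  obtain C D where "\<And>w. \<bar>h w\<bar> \<le> C" "\<And>w. \<bar>k w\<bar> \<le> D"
    using assms by (auto simp: bm_def)
  then have "\<bar>h w * k w\<bar> \<le> C * D" for w
    unfolding abs_mult by (meson abs_ge_zero mult_mono order_trans)
  with assms show ?thesis
    by (intro bmI) (auto simp: bm_def)
qed

lemma bm_const: "(\<lambda>w. c) \<in> bm M"
  by (auto simp: bm_def)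

lemma bm_diff: "h \<in> bm M \<Longrightarrow> k \<in> bm M \<Longrightarrow> (\<lambda>w. h w - k w) \<in> bm M"
  using bm_add[OF _ bm_mult[OF bm_const[of "-1"]], of h M k] by simp

lemma bm_divide: "h \<in> bm M \<Longrightarrow> (\<lambda>w. h w / c) \<in> bm M"
  using bm_mult[OF bm_const[of "1 / c"], of h M] by simp

lemma bm_power2: "h \<in> bm M \<Longrightarrow> (\<lambda>w. (h w)\<^sup>2) \<in> bm M"
  unfolding power2_eq_square by (rule bm_mult)

lemma bm_abs: "h \<in> bm M \<Longrightarrow> (\<lambda>w. \<bar>h w\<bar>) \<in> bm M"
  by (auto simp: bm_def)

lemma bm_comp: "h \<in> bm M \<Longrightarrow> t \<in> measurable M M \<Longrightarrow> (\<lambda>w. h (t w)) \<in> bm M"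
  by (auto simp: bm_def)

lemma bm_sum: "(\<And>i. i \<in> I \<Longrightarrow> h i \<in> bm M) \<Longrightarrow> (\<lambda>w. \<Sum>i\<in>I. h i w) \<in> bm M"
  by (induction I rule: infinite_finite_induct) (auto intro: bm_const bm_add)

lemma bm_avg: "(\<And>u. u \<in> A \<Longrightarrow> h u \<in> bm M) \<Longrightarrow> (\<lambda>w. avg A (\<lambda>u. h u w)) \<in> bm M"
  unfolding avg_def by (intro bm_divide bm_sum)

lemma bm_if: "(\<not> P \<Longrightarrow> h \<in> bm M) \<Longrightarrow> (\<lambda>w. if P then 0 else h w) \<in> bm M"
  by (cases P) (simp_all add: bm_const)

lemmas bm_intros = bm_add bm_diff bm_mult bm_const bm_divide bm_power2 bm_abs bm_sum bm_avg bm_if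

definition measure_preserving_map :: "'w measure \<Rightarrow> ('w \<Rightarrow> 'w) \<Rightarrow> bool" where
  "measure_preserving_map M t \<longleftrightarrow> t \<in> measurable M M \<and> distr M M t = M"

context prob_space
begin

lemma integrable_bm: "h \<in> bm M \<Longrightarrow> integrable M h"
proof -
  assume "h \<in> bm M"
  then obtain C where "h \<in> borel_measurable M" "\<And>w. \<bar>h w\<bar> \<le> C"
    by (auto simp: bm_def)
  then show "integrable M h"
    by (intro integrable_const_bound[of _ C]) auto
qed

lemma expectation_avg:
  assumes "\<And>u. u \<in> A \<Longrightarrow> h u \<in> bm M"
  shows "expectation (\<lambda>w. avg A (\<lambda>u. h u w)) = avg A (\<lambda>u. expectation (h u))"
  unfolding avg_def using assms by (simp add: integrable_bm)

text \<open>Nonnegativity of the variance; it turns bounds on second moments into bounds on expected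
  absolute values.\<close>

lemma square_expectation_le:
  assumes "h \<in> bm M"
  shows "(expectation h)\<^sup>2 \<le> expectation (\<lambda>w. (h w)\<^sup>2)"
  using variance_eq[OF integrable_bm[OF assms] integrable_bm[OF bm_power2[OF assms]]]
    variance_positive[of h] by simp

lemma expectation_mono_bm:
  assumes "h \<in> bm M" "k \<in> bm M" "\<And>w. w \<in> space M \<Longrightarrow> h w \<le> k w"
  shows "expectation h \<le> expectation k"
  using assms by (intro integral_mono integrable_bm)

lemma expectation_le:
  assumes "h \<in> bm M" "\<And>w. w \<in> space M \<Longrightarrow> h w \<le> c"
  shows "expectation h \<le> c"
  using expectation_mono_bm[OF assms(1) bm_const, of c] assms(2) prob_space by simp

lemma abs_expectation_le:
  fixes h :: "'a \<Rightarrow> real"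
  shows "\<bar>expectation h\<bar> \<le> expectation (\<lambda>w. \<bar>h w\<bar>)"
  using integral_norm_bound[of M h] by simp

lemma abs_expectation_bound:
  assumes "h \<in> bm M" "\<And>w. w \<in> space M \<Longrightarrow> \<bar>h w\<bar> \<le> c"
  shows "\<bar>expectation h\<bar> \<le> c"
  using abs_expectation_le[of h] expectation_le[OF bm_abs[OF assms(1)] assms(2)] by linarith

lemma abs_expectation_mult_le:
  assumes "h \<in> bm M" "k \<in> bm M" "\<And>w. \<bar>k w\<bar> \<le> 1"
  shows "\<bar>expectation (\<lambda>w. h w * k w)\<bar> \<le> expectation (\<lambda>w. \<bar>h w\<bar>)"
proof -
  have "\<bar>expectation (\<lambda>w. h w * k w)\<bar> \<le> expectation (\<lambda>w. \<bar>h w * k w\<bar>)"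
    by (rule abs_expectation_le)
  also have "\<dots> \<le> expectation (\<lambda>w. \<bar>h w\<bar>)"
    using assms by (intro expectation_mono_bm bm_intros) (auto simp: abs_mult mult_left_le)
  finally show ?thesis .
qed

lemma expectation_preserving:
  assumes "measure_preserving_map M t" "h \<in> bm M"
  shows "expectation (\<lambda>w. h (t w)) = expectation h"
  using integral_distr[of t M M h] assms by (simp add: measure_preserving_map_def bm_def)

end

section \<open>Almost invariant averages\<close>

text \<open>These are the dyadic convex combinations of \<open>f\<close> composed with products of
  maps from \<open>S\<close>. Midpoints are all that the parallelogram law needs, and the facts
  about the hull then follow by induction over \<open>comp\<close> and \<open>mid\<close>.\<close>

inductive_set orbit_hull :: "('w \<Rightarrow> 'w) set \<Rightarrow> ('w \<Rightarrow> real) \<Rightarrow> ('w \<Rightarrow> real) set" for S f where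
  base: "f \<in> orbit_hull S f"
| comp: "h \<in> orbit_hull S f \<Longrightarrow> t \<in> S \<Longrightarrow> (\<lambda>w. h (t w)) \<in> orbit_hull S f"
| mid: "h \<in> orbit_hull S f \<Longrightarrow> k \<in> orbit_hull S f \<Longrightarrow> (\<lambda>w. (h w + k w) / 2) \<in> orbit_hull S f"

lemma orbit_hull_range:
  assumes "h \<in> orbit_hull S f" "range f \<subseteq> {0..1}"
  shows "range h \<subseteq> {0..1}"
  using assms
proof (induction rule: orbit_hull.induct)
  case (mid h k)
  have "h w \<in> {0..1}" "k w \<in> {0..1}" for w using mid by blast+
  then show ?case by (auto intro: add_nonneg_nonneg) (smt (verit) )
qed auto

lemma orbit_hull_bm:
  assumes "h \<in> orbit_hull S f" "f \<in> bm M" "S \<subseteq> measurable M M"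
  shows "h \<in> bm M"
  using assms by (induction rule: orbit_hull.induct) (auto intro: bm_intros bm_comp)

lemma (in prob_space) orbit_hull_expectation:
  assumes "h \<in> orbit_hull S f" "f \<in> bm M" "\<And>t. t \<in> S \<Longrightarrow> measure_preserving_map M t"
  shows "expectation h = expectation f"
  using assms
proof (induction rule: orbit_hull.induct)
  case (comp h t)
  then have "h \<in> bm M"
    by (intro orbit_hull_bm[of h S f]) (auto simp: measure_preserving_map_def)
  with comp show ?case by (simp add: expectation_preserving)
next
  case (mid h k)
  then have "h \<in> bm M" "k \<in> bm M"
    by (auto intro!: orbit_hull_bm[of _ S f] simp: measure_preserving_map_def)
  with mid show ?case by (simp add: integrable_bm)
qed auto

text \<open>An element of almost minimal \<open>L\<^sup>2\<close> norm is almost invariant by the parallelogram law.\<close>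

lemma (in prob_space) almost_invariant_exists:
  assumes f: "f \<in> bm M" and S: "\<And>t. t \<in> S \<Longrightarrow> measure_preserving_map M t" and "e > 0"
  obtains h where "h \<in> orbit_hull S f" "\<And>t. t \<in> S \<Longrightarrow> expectation (\<lambda>w. \<bar>h (t w) - h w\<bar>) \<le> e"
proof -
  have S': "S \<subseteq> measurable M M"
    using S by (auto simp: measure_preserving_map_def)
  define q where "q h = expectation (\<lambda>w. (h w)\<^sup>2)" for h :: "'a \<Rightarrow> real"
  define d where "d = (INF h\<in>orbit_hull S f. q h)"
  have bdd: "bdd_below (q ` orbit_hull S f)"
    by (intro bdd_belowI[of _ 0]) (auto simp: q_def)
  have ne: "orbit_hull S f \<noteq> {}"
    using orbit_hull.base by blast
  \<comment> \<open>The parallelogram identity multiplies the excess of \<open>q h\<close> over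
    \<open>d\<close> by \<open>4\<close>, so the final bound becomes
    \<open>e\<^sup>2\<close>.\<close>
  have "d < d + e\<^sup>2 / 4"
    using \<open>e > 0\<close> by simp
  then obtain h where h: "h \<in> orbit_hull S f" "q h < d + e\<^sup>2 / 4"
    unfolding d_def using cINF_less_iff[OF ne bdd] by blast
  have hb: "h \<in> bm M"
    using orbit_hull_bm[OF h(1) f S'] .
  show thesis
  proof (rule that[OF h(1)])
    fix t assume t: "t \<in> S"
    let ?k = "\<lambda>w. h (t w)"
    have k: "?k \<in> orbit_hull S f" "?k \<in> bm M"
      using h(1) t orbit_hull.comp orbit_hull_bm[OF _ f S'] by blast+
    have qk: "q ?k = q h"
      unfolding q_def using expectation_preserving[OF S[OF t] bm_power2[OF hb]] .
    have dle: "d \<le> q (\<lambda>w. (?k w + h w) / 2)"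
      unfolding d_def using k(1) h(1) by (intro cINF_lower[OF bdd]) (rule orbit_hull.mid)
    have "(expectation (\<lambda>w. \<bar>?k w - h w\<bar>))\<^sup>2 \<le> expectation (\<lambda>w. \<bar>?k w - h w\<bar>\<^sup>2)"
      using hb k by (intro square_expectation_le bm_intros)
    also have "\<dots> = expectation (\<lambda>w. 2 * (?k w)\<^sup>2 + 2 * (h w)\<^sup>2 - 4 * ((?k w + h w) / 2)\<^sup>2)"
      by (intro arg_cong[where f = expectation]) (auto simp: power2_eq_square field_simps)
    also have "\<dots> = 2 * q ?k + 2 * q h - 4 * q (\<lambda>w. (?k w + h w) / 2)"
    proof -
      have "integrable M (\<lambda>w. (?k w)\<^sup>2)" "integrable M (\<lambda>w. (h w)\<^sup>2)"
        "integrable M (\<lambda>w. ((?k w + h w) / 2)\<^sup>2)"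
        using hb k by (intro integrable_bm bm_intros; simp)+
      moreover have "expectation (\<lambda>w. 2 * X w + 2 * Y w - 4 * Z w)
          = 2 * expectation X + 2 * expectation Y - 4 * expectation Z"
        if "integrable M X" "integrable M Y" "integrable M Z"
        for X Y Z :: "'a \<Rightarrow> real"
        using that by simp
      ultimately show ?thesis
        unfolding q_def by blast
    qed
    also have "\<dots> \<le> e\<^sup>2"
      using dle h(2) unfolding qk by linarith
    finally show "expectation (\<lambda>w. \<bar>?k w - h w\<bar>) \<le> e"
      by (rule power2_le_imp_le) (use \<open>e > 0\<close> in simp)
  qed
qed

lemma abs_half_add_le:
  fixes a b e :: real
  assumes "\<bar>a\<bar> \<le> e" "\<bar>b\<bar> \<le> e"
  shows "\<bar>(1 / 2) * (a + b)\<bar> \<le> e"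
proof -
  have "\<bar>a + b\<bar> \<le> 2 * e"
    using assms by linarith
  then show ?thesis by simp
qed

lemma abs_midpoint_diff_le:
  fixes a b c e :: real
  assumes "\<bar>a - c\<bar> \<le> e" "\<bar>b - c\<bar> \<le> e"
  shows "\<bar>(a + b) / 2 - c\<bar> \<le> e"
  using abs_half_add_le[OF assms] by (simp add: field_simps)

lemma abs_midpoint_diff_midpoint_le:
  fixes a b c d :: real
  shows "\<bar>(a + b) / 2 - (c + d) / 2\<bar> \<le> (\<bar>a - c\<bar> + \<bar>b - d\<bar>) / 2"
  by (simp add: abs_if field_simps)

text \<open>Invariance of the measure moves a map \<open>t\<close> from \<open>f\<close> over to
  \<open>k\<close>, where it costs \<open>e\<close>. The extra \<open>t\<close> in the conclusion
  strengthens the induction: a further composition is merged with \<open>t\<close> into a single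
  element of \<open>S\<close> by \<open>closed\<close>, so the error stays \<open>e\<close> however
  many maps were composed.\<close>

lemma (in prob_space) orbit_hull_pairing:
  assumes f: "f \<in> bm M" "\<And>w. \<bar>f w\<bar> \<le> 1" and k: "k \<in> bm M"
    and S: "\<And>t. t \<in> S \<Longrightarrow> measure_preserving_map M t"
    and inv: "\<And>t. t \<in> S \<Longrightarrow> expectation (\<lambda>w. \<bar>k (t w) - k w\<bar>) \<le> e"
    and closed: "\<And>s t. s \<in> S \<Longrightarrow> t \<in> S \<Longrightarrow> \<exists>r\<in>S. \<forall>w\<in>space M. s (t w) = r w"
    and h: "h \<in> orbit_hull S f" and "t \<in> S"
  shows "\<bar>expectation (\<lambda>w. k w * h (t w)) - expectation (\<lambda>w. k w * f w)\<bar> \<le> e"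
  using h \<open>t \<in> S\<close>
proof (induction arbitrary: t rule: orbit_hull.induct)
  case base
  then have t: "measure_preserving_map M t" "t \<in> measurable M M"
    using S by (auto simp: measure_preserving_map_def)
  have "expectation (\<lambda>w. k w * f w) = expectation (\<lambda>w. k (t w) * f (t w))"
    using expectation_preserving[OF t(1) bm_mult[OF k f(1)]] by simp
  moreover have kt: "(\<lambda>w. k (t w)) \<in> bm M" "(\<lambda>w. f (t w)) \<in> bm M"
    using k f(1) t(2) by (auto intro: bm_comp)
  ultimately have "expectation (\<lambda>w. k w * f w) - expectation (\<lambda>w. k w * f (t w))
      = expectation (\<lambda>w. (k (t w) - k w) * f (t w))"
    using k by (simp add: integrable_bm bm_mult left_diff_distrib)
  also have "\<bar>\<dots>\<bar> \<le> expectation (\<lambda>w. \<bar>k (t w) - k w\<bar>)"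
    using k kt f(2) by (intro abs_expectation_mult_le bm_diff)
  finally show ?case
    using inv[OF base] by simp
next
  case (comp h s)
  obtain r where r: "r \<in> S" "\<forall>w\<in>space M. s (t w) = r w"
    using closed comp by blast
  then have "expectation (\<lambda>w. k w * h (s (t w))) = expectation (\<lambda>w. k w * h (r w))"
    by (intro Bochner_Integration.integral_cong) auto
  with comp.IH[OF r(1)] show ?case by simp
next
  case (mid h1 h2)
  have t: "t \<in> measurable M M" "S \<subseteq> measurable M M"
    using S mid by (auto simp: measure_preserving_map_def)
  have "h1 \<in> bm M" "h2 \<in> bm M"
    using orbit_hull_bm[OF _ f(1) t(2)] mid.hyps by blast+
  note bm_comp[OF this(1) t(1)] bm_comp[OF this(2) t(1)]
  with k have "expectation (\<lambda>w. k w * ((h1 (t w) + h2 (t w)) / 2))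
      = (expectation (\<lambda>w. k w * h1 (t w)) + expectation (\<lambda>w. k w * h2 (t w))) / 2"
    by (simp add: integrable_bm bm_mult distrib_left)
  then show ?case
    using abs_midpoint_diff_le[OF mid.IH[OF mid.prems]] by simp
qed

section \<open>Actions of the affine group\<close>

locale affine_action = prob_space M for M :: "'w measure" +
  fixes T :: "('k::field \<Rightarrow> 'k) \<Rightarrow> 'w \<Rightarrow> 'w"
  assumes action: "measure_preserving_action affine_group M T"
begin

sublocale group_action affine_group "space M" T
  using action by (simp add: measure_preserving_action_def)

definition act :: "'k \<Rightarrow> 'k \<Rightarrow> 'w \<Rightarrow> 'w" where
  "act a b = T (\<lambda>x. a * x + b)"

lemma act_preserving:
  assumes "a \<noteq> 0"
  shows "measure_preserving_map M (act a b)"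
proof -
  have t: "act a b \<in> measurable M M"
    "\<And>B. B \<in> sets M \<Longrightarrow> emeasure M (act a b -` B \<inter> space M) = emeasure M B"
    using action affine_groupI[OF assms, of b]
    by (auto simp: measure_preserving_action_def act_def)
  have "distr M M (act a b) = M"
    by (rule measure_eqI) (auto simp: emeasure_distr t)
  with t show ?thesis by (simp add: measure_preserving_map_def)
qed

lemma act_measurable: "a \<noteq> 0 \<Longrightarrow> act a b \<in> measurable M M"
  using act_preserving by (simp add: measure_preserving_map_def)

lemma bm_act: "h \<in> bm M \<Longrightarrow> a \<noteq> 0 \<Longrightarrow> (\<lambda>w. h (act a b w)) \<in> bm M"
  by (rule bm_comp[OF _ act_measurable])

lemma act_space: "a \<noteq> 0 \<Longrightarrow> w \<in> space M \<Longrightarrow> act a b w \<in> space M"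
  using act_measurable by (rule measurable_space)

lemma act_act:
  assumes "a \<noteq> 0" "c \<noteq> 0" "w \<in> space M"
  shows "act a b (act c d w) = act (a * c) (a * d + b) w"
proof -
  have "(\<lambda>x. a * x + b) \<otimes>\<^bsub>affine_group\<^esub> (\<lambda>x. c * x + d) = (\<lambda>x. (a * c) * x + (a * d + b))"
    by (auto simp: affine_group_def fun_eq_iff algebra_simps)
  then show ?thesis
    using composition_rule[OF assms(3) affine_groupI[OF assms(1), of b] affine_groupI[OF assms(2), of d]]
    by (simp add: act_def)
qed

lemma act_one: "w \<in> space M \<Longrightarrow> act 1 0 w = w"
proof -
  have "(\<lambda>x. 1 * x + 0) = \<one>\<^bsub>affine_group\<^esub>"
    by (auto simp: affine_group_def)
  then show "w \<in> space M \<Longrightarrow> act 1 0 w = w"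
    unfolding act_def using id_eq_one by (metis restrict_apply')
qed

text \<open>The sets in the theorem are images, while their indicators need a condition on
  \<open>w\<close>; the inverse of \<open>x \<mapsto> a * x + b\<close> has slope
  \<open>1 / a\<close> and constant term \<open>- b / a\<close>.\<close>

lemma act_image:
  assumes "a \<noteq> 0" "B \<subseteq> space M"
  shows "act a b ` B = {w \<in> space M. act (1 / a) (- b / a) w \<in> B}"
proof safe
  fix w assume "w \<in> B"
  with assms have w: "w \<in> space M" by auto
  then show "act a b w \<in> space M" using assms act_space by blast
  show "act (1 / a) (- b / a) (act a b w) \<in> B"
    using assms w \<open>w \<in> B\<close> by (simp add: act_act act_one)
next
  fix w assume w: "w \<in> space M" "act (1 / a) (- b / a) w \<in> B"
  have "act a b (act (1 / a) (- b / a) w) = w"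
    using assms w by (simp add: act_act act_one)
  then show "w \<in> act a b ` B" using w by (metis imageI)
qed

section \<open>Averages along shifts and dilations\<close>

definition "shifts = range (act 1)"
definition "dilations = (\<lambda>a. act a 0) ` (- {0})"

lemma shifts_preserving: "t \<in> shifts \<Longrightarrow> measure_preserving_map M t"
  by (auto simp: shifts_def act_preserving)

lemma dilations_preserving: "t \<in> dilations \<Longrightarrow> measure_preserving_map M t"
  by (auto simp: dilations_def intro: act_preserving)

lemma shifts_closed: "s \<in> shifts \<Longrightarrow> t \<in> shifts \<Longrightarrow> \<exists>r\<in>shifts. \<forall>w\<in>space M. s (t w) = r w"
  by (auto simp: shifts_def act_act)

lemma dilations_closed:
  "s \<in> dilations \<Longrightarrow> t \<in> dilations \<Longrightarrow> \<exists>r\<in>dilations. \<forall>w\<in>space M. s (t w) = r w"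
  by (auto simp: dilations_def act_act)

text \<open>Both families contain \<open>act 1 0\<close>, so this is
  \<open>orbit_hull_pairing\<close> at the identity. That map is known to be the identity on
  \<open>space M\<close> only, hence the congruence of integrals.\<close>

lemma orbit_hull_pairing_id:
  assumes "f \<in> bm M" "\<And>w. \<bar>f w\<bar> \<le> 1" "k \<in> bm M" "S = shifts \<or> S = dilations"
    and "\<And>t. t \<in> S \<Longrightarrow> expectation (\<lambda>w. \<bar>k (t w) - k w\<bar>) \<le> e" "h \<in> orbit_hull S f"
  shows "\<bar>expectation (\<lambda>w. k w * h w) - expectation (\<lambda>w. k w * f w)\<bar> \<le> e"
proof -
  have "act 1 0 \<in> S"
    using assms(4) by (auto simp: shifts_def dilations_def)
  moreover have "expectation (\<lambda>w. k w * h (act 1 0 w)) = expectation (\<lambda>w. k w * h w)"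
    by (intro Bochner_Integration.integral_cong) (auto simp: act_one)
  ultimately show ?thesis
    using orbit_hull_pairing[of f k S e h "act 1 0"] assms shifts_preserving dilations_preserving
      shifts_closed dilations_closed by auto
qed

text \<open>Composing with the shift by \<open>v\<close> amounts to translating \<open>u\<close> by
  \<open>v / c\<close>, which the averages hardly notice. Every such step costs
  \<open>e / 2\<close>, so the induction keeps \<open>e\<close> arbitrary. The factor
  \<open>c\<close> anticipates the shifts by \<open>u * c\<close> in the correlations of
  \<open>van_der_Corput_correlation\<close>.\<close>

lemma shift_hull_average:
  assumes F: "double_Folner_sequence F" and h: "h \<in> orbit_hull shifts f"
    and f: "range f \<subseteq> {0..1}" and "c \<noteq> 0" "e > 0"
  shows "\<forall>\<^sub>F N in sequentially. \<forall>w\<in>space M.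
           \<bar>avg (F N) (\<lambda>u. f (act 1 (u * c) w) - h (act 1 (u * c) w))\<bar> \<le> e"
  using h \<open>e > 0\<close>
proof (induction arbitrary: e rule: orbit_hull.induct)
  case base
  then show ?case by (simp add: avg_def)
next
  case (comp h t)
  obtain v where v: "t = act 1 v"
    using comp by (auto simp: shifts_def)
  have h1: "\<bar>h w\<bar> \<le> 1" for w
    using orbit_hull_range[OF comp.hyps(1) f] by (auto simp: image_subset_iff)
  have e2: "e / 2 > 0" using comp.prems by simp
  show ?case
    using comp.IH[OF e2] Folner_add_shift[OF F e2, of "v / c"]
  proof eventually_elim
    case (elim N)
    show ?case
    proof
      fix w assume w: "w \<in> space M"
      have "\<bar>avg (F N) (\<lambda>u. h (act 1 (u * c) w)) - avg (F N) (\<lambda>u. h (act 1 ((u + v / c) * c) w))\<bar> \<le> e / 2"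
        using elim(2)[rule_format, of "\<lambda>u. h (act 1 (u * c) w)"] h1 by blast
      moreover have "h (act 1 ((u + v / c) * c) w) = h (t (act 1 (u * c) w))" for u
        using w \<open>c \<noteq> 0\<close> by (simp add: v act_act distrib_right add.commute)
      ultimately have "\<bar>avg (F N) (\<lambda>u. h (act 1 (u * c) w)) - avg (F N) (\<lambda>u. h (t (act 1 (u * c) w)))\<bar> \<le> e / 2"
        by simp
      moreover have "\<bar>avg (F N) (\<lambda>u. f (act 1 (u * c) w)) - avg (F N) (\<lambda>u. h (act 1 (u * c) w))\<bar> \<le> e / 2"
        using elim(1)[rule_format, OF w] unfolding avg_diff .
      ultimately show "\<bar>avg (F N) (\<lambda>u. f (act 1 (u * c) w) - h (t (act 1 (u * c) w)))\<bar> \<le> e"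
        unfolding avg_diff by linarith
    qed
  qed
next
  case (mid h k)
  show ?case
    using mid.IH(1)[OF mid.prems] mid.IH(2)[OF mid.prems]
  proof eventually_elim
    case (elim N)
    have eq: "avg (F N) (\<lambda>u. f (act 1 (u * c) w) - (h (act 1 (u * c) w) + k (act 1 (u * c) w)) / 2)
       = (1 / 2) * (avg (F N) (\<lambda>u. f (act 1 (u * c) w) - h (act 1 (u * c) w)) +
          avg (F N) (\<lambda>u. f (act 1 (u * c) w) - k (act 1 (u * c) w)))" for w
      unfolding avg_add[symmetric] avg_cmult[symmetric] by (intro avg_cong) (simp add: field_simps)
    show ?case
      unfolding eq by (intro ballI abs_half_add_le) (use elim in blast)+
  qed
qed

text \<open>The multiplicative counterpart of \<open>shift_hull_average\<close>: composing with the
  dilation by \<open>v\<close> turns \<open>1 / u\<close> into \<open>v / u\<close>, that is,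
  replaces \<open>u\<close> by \<open>u / v\<close>.\<close>

lemma dilation_hull_average:
  assumes F: "double_Folner_sequence F" and h: "h \<in> orbit_hull dilations f"
    and f: "range f \<subseteq> {0..1}" and "e > 0"
  shows "\<forall>\<^sub>F N in sequentially. \<forall>w\<in>space M.
           \<bar>avg (F N) (\<lambda>u. if u = 0 then 0 else f (act (1 / u) 0 w) - h (act (1 / u) 0 w))\<bar> \<le> e"
  using h \<open>e > 0\<close>
proof (induction arbitrary: e rule: orbit_hull.induct)
  case base
  then show ?case by (simp add: avg_def cong: if_cong)
next
  case (comp h t)
  obtain v where v: "t = act v 0" "v \<noteq> 0"
    using comp by (auto simp: dilations_def)
  have h1: "\<bar>h w\<bar> \<le> 1" for w
    using orbit_hull_range[OF comp.hyps(1) f] by (auto simp: image_subset_iff)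
  have e2: "e / 2 > 0" using comp.prems by simp
  have v': "1 / v \<noteq> 0" using v by simp
  show ?case
    using comp.IH[OF e2] Folner_mult_shift[OF F e2 v']
  proof eventually_elim
    case (elim N)
    show ?case
    proof
      fix w assume w: "w \<in> space M"
      \<comment> \<open>The map \<open>u \<mapsto> u / v\<close> fixes \<open>0\<close> and no other
        point goes to \<open>0\<close>, so the substitution respects the exclusion of
        \<open>u = 0\<close>.\<close>
      define \<phi> where "\<phi> u = (if u = 0 then 0 else h (act (1 / u) 0 w))" for u
      have "\<bar>avg (F N) \<phi> - avg (F N) (\<lambda>u. \<phi> (1 / v * u))\<bar> \<le> e / 2"
        using elim(2)[rule_format, of \<phi>] h1 by (simp add: \<phi>_def)
      moreover have "avg (F N) (\<lambda>u. if u = 0 then 0 else f (act (1 / u) 0 w) - h (t (act (1 / u) 0 w)))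
         = avg (F N) (\<lambda>u. if u = 0 then 0 else f (act (1 / u) 0 w) - h (act (1 / u) 0 w))
           + (avg (F N) \<phi> - avg (F N) (\<lambda>u. \<phi> (1 / v * u)))"
        unfolding avg_add[symmetric] avg_diff[symmetric]
        by (intro avg_cong) (use w v in \<open>auto simp: \<phi>_def act_act\<close>)
      ultimately show "\<bar>avg (F N) (\<lambda>u. if u = 0 then 0
          else f (act (1 / u) 0 w) - h (t (act (1 / u) 0 w)))\<bar> \<le> e"
        using elim(1)[rule_format, OF w] by linarith
    qed
  qed
next
  case (mid h k)
  show ?case
    using mid.IH(1)[OF mid.prems] mid.IH(2)[OF mid.prems]
  proof eventually_elim
    case (elim N)
    have eq: "avg (F N) (\<lambda>u. if u = 0 then 0
          else f (act (1 / u) 0 w) - (h (act (1 / u) 0 w) + k (act (1 / u) 0 w)) / 2)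
       = (1 / 2) * (avg (F N) (\<lambda>u. if u = 0 then 0 else f (act (1 / u) 0 w) - h (act (1 / u) 0 w)) +
          avg (F N) (\<lambda>u. if u = 0 then 0 else f (act (1 / u) 0 w) - k (act (1 / u) 0 w)))" for w
      unfolding avg_add[symmetric] avg_cmult[symmetric] by (intro avg_cong) (simp add: field_simps)
    show ?case
      unfolding eq by (intro ballI abs_half_add_le) (use elim in blast)+
  qed
qed

text \<open>Dilations normalise the group of shifts.\<close>

lemma dilation_hull_invariant:
  assumes k: "k \<in> orbit_hull dilations h" and h: "h \<in> bm M"
    and inv: "\<And>t. t \<in> shifts \<Longrightarrow> expectation (\<lambda>w. \<bar>h (t w) - h w\<bar>) \<le> e"
    and "t \<in> shifts"
  shows "expectation (\<lambda>w. \<bar>k (t w) - k w\<bar>) \<le> e"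
proof -
  have bm: "k \<in> bm M" if "k \<in> orbit_hull dilations h" for k
    using dilations_preserving by (intro orbit_hull_bm[OF that h]) (auto simp: measure_preserving_map_def)
  have "expectation (\<lambda>w. \<bar>k (act 1 v w) - k w\<bar>) \<le> e" for v
    using k
  proof (induction arbitrary: v rule: orbit_hull.induct)
    case base
    then show ?case using inv by (simp add: shifts_def)
  next
    case (comp k t)
    then obtain j where j: "t = act j 0" "j \<noteq> 0"
      by (auto simp: dilations_def)
    \<comment> \<open>Moving the dilation by \<open>j\<close> past the shift by \<open>v\<close>
      turns the latter into the shift by \<open>j * v\<close>, which is why \<open>v\<close> is
      arbitrary in the induction. The dilation then disappears by invariance of the measure.\<close>
    have "expectation (\<lambda>w. \<bar>k (t (act 1 v w)) - k (t w)\<bar>)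
       = expectation (\<lambda>w. \<bar>k (act 1 (j * v) (act j 0 w)) - k (act j 0 w)\<bar>)"
      by (intro Bochner_Integration.integral_cong) (use j in \<open>auto simp: act_act\<close>)
    also have "\<dots> = expectation (\<lambda>w. \<bar>k (act 1 (j * v) w) - k w\<bar>)"
      using bm[OF comp.hyps(1)] j
      by (intro expectation_preserving[of "act j 0" "\<lambda>w. \<bar>k (act 1 (j * v) w) - k w\<bar>"]
          act_preserving bm_intros bm_act) auto
    also have "\<dots> \<le> e"
      by (rule comp.IH)
    finally show ?case .
  next
    case (mid k1 k2)
    note b = bm[OF mid.hyps(1)] bm[OF mid.hyps(2)]
    let ?d = "\<lambda>k w. \<bar>k (act 1 v w) - k w\<bar>"
    have d: "?d k1 \<in> bm M" "?d k2 \<in> bm M"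
      using b by (intro bm_intros bm_act; simp)+
    have "expectation (\<lambda>w. \<bar>(k1 (act 1 v w) + k2 (act 1 v w)) / 2 - (k1 w + k2 w) / 2\<bar>)
       \<le> expectation (\<lambda>w. (?d k1 w + ?d k2 w) / 2)"
    proof (intro expectation_mono_bm)
      fix w
      show "\<bar>(k1 (act 1 v w) + k2 (act 1 v w)) / 2 - (k1 w + k2 w) / 2\<bar> \<le> (?d k1 w + ?d k2 w) / 2"
        by (rule abs_midpoint_diff_midpoint_le)
    qed (use b in \<open>intro bm_intros bm_act; simp\<close>)+
    also have "\<dots> = (expectation (?d k1) + expectation (?d k2)) / 2"
      using d by (simp add: integrable_bm)
    also have "\<dots> \<le> e"
      using mid.IH[of v] by simp
    finally show ?case .
  qed
  with \<open>t \<in> shifts\<close> show ?thesis by (auto simp: shifts_def)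
qed

section \<open>The van der Corput argument\<close>

text \<open>A measure preserving substitution turns the product into a shift of \<open>g\<close> by
  \<open>u * c\<close>, taken at a point independent of \<open>u\<close>, times a factor free of
  \<open>u\<close>. The average over \<open>u\<close> can then be taken pointwise, where
  \<open>null\<close> applies.\<close>

lemma van_der_Corput_correlation:
  assumes F: "double_Folner_sequence F" and inf: "infinite (UNIV :: 'k set)"
    and g: "g \<in> bm M" and g1: "\<And>w. \<bar>g w\<bar> \<le> 1"
    and null: "\<And>c e. c \<noteq> 0 \<Longrightarrow> e > 0 \<Longrightarrow> \<forall>\<^sub>F N in sequentially. \<forall>w\<in>space M.
           \<bar>avg (F N) (\<lambda>u. g (act 1 (u * c) w))\<bar> \<le> e"
    and b: "b \<noteq> 0" "b' \<noteq> 0" "b * b \<noteq> b' * b'" and "e > 0"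
  defines "a \<equiv> \<lambda>u w. if u = 0 then 0 else g (act (1 / u) u w)"
  shows "\<forall>\<^sub>F N in sequentially.
           \<bar>avg (F N) (\<lambda>u. expectation (\<lambda>w. a (b * u) w * a (b' * u) w))\<bar> \<le> e"
proof -
  \<comment> \<open>After the substitution the first factor is shifted by
    \<open>u * b - u * b' * b' / b\<close>. The coefficient of \<open>u\<close> is nonzero because
    the squares differ.\<close>
  define c where "c = b - b' * b' / b"
  have c: "c \<noteq> 0"
    using b by (auto simp: c_def field_simps)
  let ?h = "\<lambda>u w. if u = 0 then 0 else g (act 1 (u * c) (act (1 / b) 0 w))"
  let ?k = "\<lambda>w. g (act (1 / b') 0 w)"
  have k: "?k \<in> bm M" and h: "?h u \<in> bm M" for u
  proof -
    have "(\<lambda>w. (\<lambda>w. g (act 1 (u * c) w)) (act (1 / b) 0 w)) \<in> bm M"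
      using b by (intro bm_act g) auto
    then show "?h u \<in> bm M" by (intro bm_if)
  qed (use b in \<open>intro bm_act g; simp\<close>)
  \<comment> \<open>The substitution is along \<open>x \<mapsto> u (x - u b'\<^sup>2)\<close>, which removes \<open>u\<close> from the second factor.\<close>
  have corr: "expectation (\<lambda>w. a (b * u) w * a (b' * u) w) = expectation (\<lambda>w. ?h u w * ?k w)" for u
  proof (cases "u = 0")
    case False
    let ?H = "\<lambda>w. g (act (1 / (b * u)) (b * u) w) * g (act (1 / (b' * u)) (b' * u) w)"
    let ?t = "act u (- (u * u * b' * b'))"
    have H: "?H \<in> bm M"
      using b False by (intro bm_mult bm_act g) auto
    have "expectation (\<lambda>w. a (b * u) w * a (b' * u) w) = expectation ?H"
      using b False by (simp add: a_def)
    also have "\<dots> = expectation (\<lambda>w. ?H (?t w))"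
      using expectation_preserving[OF act_preserving[OF False] H] by (rule sym)
    also have "\<dots> = expectation (\<lambda>w. ?h u w * ?k w)"
    proof (rule Bochner_Integration.integral_cong[OF refl])
      fix w assume w: "w \<in> space M"
      have "act (1 / (b' * u)) (b' * u) (?t w) = act (1 / b') 0 w"
      proof -
        have "1 / (b' * u) * u = 1 / b'" "1 / (b' * u) * (- (u * u * b' * b')) + b' * u = 0"
          using b False by (simp_all add: field_simps)
        then show ?thesis
          using act_act[of "1 / (b' * u)" u w "b' * u" "- (u * u * b' * b')"] w b False by simp
      qed
      moreover have "act (1 / (b * u)) (b * u) (?t w) = act 1 (u * c) (act (1 / b) 0 w)"
      proof -
        have "1 / (b * u) * u = 1 / b" "1 / (b * u) * (- (u * u * b' * b')) + b * u = u * c"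
          using b False by (simp_all add: c_def field_simps)
        then show ?thesis
          using act_act[of "1 / (b * u)" u w "b * u" "- (u * u * b' * b')"]
            act_act[of 1 "1 / b" w "u * c" 0] w b False by simp
      qed
      ultimately show "?H (?t w) = ?h u w * ?k w"
        using False by simp
    qed
    finally show ?thesis .
  qed (simp add: a_def)
  have e2: "e / 2 > 0" using \<open>e > 0\<close> by simp
  show ?thesis
    using null[OF c e2] Folner_point[OF F inf e2]
  proof eventually_elim
    case (elim N)
    have "avg (F N) (\<lambda>u. expectation (\<lambda>w. a (b * u) w * a (b' * u) w))
        = expectation (\<lambda>w. avg (F N) (\<lambda>u. ?h u w * ?k w))"
      unfolding corr using h k by (intro expectation_avg[symmetric] bm_mult)
    also have "\<bar>\<dots>\<bar> \<le> e"
    proof (rule abs_expectation_bound)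
      show "(\<lambda>w. avg (F N) (\<lambda>u. ?h u w * ?k w)) \<in> bm M"
        using h k by (intro bm_avg bm_mult)
      fix w assume w: "w \<in> space M"
      let ?v = "act (1 / b) 0 w"
      have v: "?v \<in> space M"
        using w b by (intro act_space) auto
      \<comment> \<open>\<open>null\<close> averages over all \<open>u\<close>, but
        \<open>?h\<close> vanishes at \<open>u = 0\<close>. The missing term costs one half of
        \<open>e\<close>, and \<open>null\<close> at the point \<open>?v\<close> the other.\<close>
      have "\<bar>avg (F N) (\<lambda>u. g (act 1 (u * c) ?v)) - avg (F N) (\<lambda>u. ?h u w)\<bar> \<le> e / 2"
        by (rule order_trans[OF avg_punctured[OF g1] elim(2)])
      moreover have "\<bar>avg (F N) (\<lambda>u. g (act 1 (u * c) ?v))\<bar> \<le> e / 2"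
        using elim(1) v by blast
      ultimately have "\<bar>avg (F N) (\<lambda>u. ?h u w)\<bar> \<le> e"
        by linarith
      then have "\<bar>avg (F N) (\<lambda>u. ?h u w)\<bar> * \<bar>?k w\<bar> \<le> e * 1"
        using g1 by (intro mult_mono) auto
      then show "\<bar>avg (F N) (\<lambda>u. ?h u w * ?k w)\<bar> \<le> e"
        unfolding avg_multc abs_mult by simp
    qed
    finally show ?case .
  qed
qed

text \<open>Averaging over \<open>b\<close> in a set of \<open>m\<close> elements with distinct squares leaves only the
  diagonal correlations, which contribute \<open>1 / m\<close>.\<close>

lemma van_der_Corput:
  assumes F: "double_Folner_sequence F" and inf: "infinite (UNIV :: 'k set)"
    and g: "g \<in> bm M" and g1: "\<And>w. \<bar>g w\<bar> \<le> 1"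
    and null: "\<And>c e. c \<noteq> 0 \<Longrightarrow> e > 0 \<Longrightarrow> \<forall>\<^sub>F N in sequentially. \<forall>w\<in>space M.
           \<bar>avg (F N) (\<lambda>u. g (act 1 (u * c) w))\<bar> \<le> e"
    and "e > 0"
  shows "\<forall>\<^sub>F N in sequentially.
           expectation (\<lambda>w. \<bar>avg (F N) (\<lambda>u. if u = 0 then 0 else g (act (1 / u) u w))\<bar>) \<le> e"
proof -
  define a where "a u w = (if u = 0 then 0 else g (act (1 / u) u w))" for u w
  have a: "a u \<in> bm M" for u
    unfolding a_def by (intro bm_if bm_act g) auto
  have a1: "\<bar>a u w\<bar> \<le> 1" for u w
    using g1 by (simp add: a_def)
  \<comment> \<open>The diagonal contributes \<open>1 / m \<le> d\<close> and the rest at most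
    \<open>d\<close>; together this is \<open>2 * d = (e / 2)\<^sup>2\<close>, leaving
    \<open>e / 2\<close> for replacing \<open>?G\<close> by \<open>H\<close>.\<close>
  define d where "d = e\<^sup>2 / 8"
  have d: "d > 0" using \<open>e > 0\<close> by (simp add: d_def)
  obtain n where n: "1 / real (Suc n) < d"
    using nat_approx_posE[OF d] by blast
  define m where "m = Suc n"
  have m: "m > 0" "1 / real m \<le> d" using n by (auto simp: m_def)
  obtain X :: "'k set" where X: "finite X" "card X = m" "0 \<notin> X" "inj_on (\<lambda>b. b * b) X"
    using distinct_squares[OF inf] by blast
  define I where "I b b' u = expectation (\<lambda>w. a (b * u) w * a (b' * u) w)" for b b' u
  have e2: "e / 2 > 0" using \<open>e > 0\<close> by simp
  have ev1: "\<forall>\<^sub>F N in sequentially. \<forall>b\<in>X. \<forall>\<phi>. (\<forall>u. \<bar>\<phi> u\<bar> \<le> 1) \<longrightarrow>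
           \<bar>avg (F N) \<phi> - avg (F N) (\<lambda>u. \<phi> (b * u))\<bar> \<le> e / 2"
    using X by (intro eventually_ball_finite ballI Folner_mult_shift F e2) auto
  have ev2: "\<forall>\<^sub>F N in sequentially. \<forall>b\<in>X. \<forall>b'\<in>X - {b}. \<bar>avg (F N) (I b b')\<bar> \<le> d"
  proof (intro eventually_ball_finite ballI)
    fix b b' assume "b \<in> X" "b' \<in> X - {b}"
    with X have b: "b \<noteq> 0" "b' \<noteq> 0" "b * b \<noteq> b' * b'"
      by (auto dest: inj_onD)
    show "\<forall>\<^sub>F N in sequentially. \<bar>avg (F N) (I b b')\<bar> \<le> d"
      unfolding I_def a_def using van_der_Corput_correlation[OF F inf g g1 null b d] .
  qed (use X in auto)
  show ?thesis
    using ev1 ev2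
  proof eventually_elim
    case (elim N)
    let ?G = "\<lambda>w. avg (F N) (\<lambda>u. a u w)"
    \<comment> \<open>By multiplicative invariance the average hardly changes when \<open>u\<close>
      becomes \<open>b * u\<close>; taking the mean over \<open>b\<close> before squaring is what
      produces the correlations \<open>I b b'\<close>.\<close>
    define H where "H w = avg (F N) (\<lambda>u. (\<Sum>b\<in>X. a (b * u) w) / m)" for w
    have bmG: "?G \<in> bm M" and bmH: "H \<in> bm M"
      unfolding H_def by (intro bm_avg bm_divide bm_sum a)+
    have GH: "\<bar>?G w - H w\<bar> \<le> e / 2" for w
    proof -
      have "m * H w = (\<Sum>b\<in>X. avg (F N) (\<lambda>u. a (b * u) w))"
        using m avg_multc[of "F N" "\<lambda>u. \<Sum>b\<in>X. a (b * u) w" "1 / m"] by (simp add: H_def avg_sum)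
      then have "m * (?G w - H w) = (\<Sum>b\<in>X. ?G w - avg (F N) (\<lambda>u. a (b * u) w))"
        using X by (simp add: sum_subtractf right_diff_distrib)
      also have "\<bar>\<dots>\<bar> \<le> (\<Sum>b\<in>X. e / 2)"
      proof (intro order_trans[OF sum_abs] sum_mono)
        fix b assume "b \<in> X"
        then show "\<bar>?G w - avg (F N) (\<lambda>u. a (b * u) w)\<bar> \<le> e / 2"
          using elim(1)[rule_format, of b "\<lambda>u. a u w"] a1 by blast
      qed
      finally have "m * \<bar>?G w - H w\<bar> \<le> m * (e / 2)"
        using X by (simp add: abs_mult)
      then show ?thesis
        using m by (simp only: mult_le_cancel_left_pos of_nat_0_less_iff)
    qed
    have "(expectation (\<lambda>w. \<bar>H w\<bar>))\<^sup>2 \<le> expectation (\<lambda>w. \<bar>H w\<bar>\<^sup>2)"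
      using bmH by (intro square_expectation_le bm_abs)
    also have "\<dots> \<le> expectation (\<lambda>w. avg (F N) (\<lambda>u. ((\<Sum>b\<in>X. a (b * u) w) / m)\<^sup>2))"
    proof (intro expectation_mono_bm bm_avg bm_power2 bm_divide bm_sum a bm_abs bmH)
      show "\<bar>H w\<bar>\<^sup>2 \<le> avg (F N) (\<lambda>u. ((\<Sum>b\<in>X. a (b * u) w) / m)\<^sup>2)" for w
        unfolding H_def power2_abs by (rule avg_square_le)
    qed
    also have "\<dots> = avg (F N) (\<lambda>u. expectation (\<lambda>w. ((\<Sum>b\<in>X. a (b * u) w) / m)\<^sup>2))"
      by (intro expectation_avg bm_power2 bm_divide bm_sum a)
    also have "\<dots> = avg (F N) (\<lambda>u. (\<Sum>b\<in>X. \<Sum>b'\<in>X. I b b' u) * (1 / m\<^sup>2))"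
    proof (intro avg_cong)
      fix u
      have "expectation (\<lambda>w. ((\<Sum>b\<in>X. a (b * u) w) / m)\<^sup>2)
          = expectation (\<lambda>w. (\<Sum>b\<in>X. \<Sum>b'\<in>X. a (b * u) w * a (b' * u) w) * (1 / m\<^sup>2))"
        by (simp add: power_divide power2_eq_square sum_product)
      also have "\<dots> = expectation (\<lambda>w. \<Sum>b\<in>X. \<Sum>b'\<in>X. a (b * u) w * a (b' * u) w) * (1 / m\<^sup>2)"
        by (rule integral_mult_left_zero)
      also have "expectation (\<lambda>w. \<Sum>b\<in>X. \<Sum>b'\<in>X. a (b * u) w * a (b' * u) w)
          = (\<Sum>b\<in>X. expectation (\<lambda>w. \<Sum>b'\<in>X. a (b * u) w * a (b' * u) w))"
        by (intro Bochner_Integration.integral_sum integrable_bm bm_sum bm_mult a)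
      also have "\<dots> = (\<Sum>b\<in>X. \<Sum>b'\<in>X. I b b' u)"
        unfolding I_def
        by (intro sum.cong refl Bochner_Integration.integral_sum integrable_bm bm_mult a)
      finally show "expectation (\<lambda>w. ((\<Sum>b\<in>X. a (b * u) w) / m)\<^sup>2)
          = (\<Sum>b\<in>X. \<Sum>b'\<in>X. I b b' u) * (1 / m\<^sup>2)" .
    qed
    also have "\<dots> = (\<Sum>b\<in>X. \<Sum>b'\<in>X. avg (F N) (I b b')) * (1 / m\<^sup>2)"
      unfolding avg_multc avg_sum ..
    \<comment> \<open>Diagonal terms are at most \<open>1\<close> since \<open>g\<close> is bounded
      by \<open>1\<close>. Granting them an extra \<open>d\<close> gives the double sum the closed
      form \<open>m + m\<^sup>2 * d\<close>.\<close>
    also have "\<dots> \<le> (\<Sum>b\<in>X. \<Sum>b'\<in>X. (if b' = b then 1 else 0) + d) * (1 / m\<^sup>2)"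
    proof (intro mult_right_mono sum_mono)
      fix b b' assume bb: "b \<in> X" "b' \<in> X"
      show "avg (F N) (I b b') \<le> (if b' = b then 1 else 0) + d"
      proof (cases "b' = b")
        case True
        have "\<bar>I b b' u\<bar> \<le> 1" for u
          unfolding I_def using a1
          by (intro abs_expectation_bound bm_mult a) (simp add: abs_mult mult_le_one)
        then have "\<bar>avg (F N) (I b b')\<bar> \<le> 1"
          by (intro avg_bounded) auto
        with True d show ?thesis by simp
      next
        case False
        with bb have "b \<in> X" "b' \<in> X - {b}" by auto
        with elim(2) have "\<bar>avg (F N) (I b b')\<bar> \<le> d" by blast
        with False show ?thesis by simp
      qed
    qed simp
    also have "(\<Sum>b\<in>X. \<Sum>b'\<in>X. (if b' = b then 1 else 0) + d) = m + m\<^sup>2 * d"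
      using X by (simp add: sum.distrib power2_eq_square algebra_simps)
    also have "(m + m\<^sup>2 * d) * (1 / m\<^sup>2) = 1 / m + d"
      using m by (simp add: field_simps power2_eq_square)
    also have "\<dots> \<le> (e / 2)\<^sup>2"
      using m by (simp add: d_def power2_eq_square)
    finally have "(expectation (\<lambda>w. \<bar>H w\<bar>))\<^sup>2 \<le> (e / 2)\<^sup>2" .
    then have EH: "expectation (\<lambda>w. \<bar>H w\<bar>) \<le> e / 2"
      by (rule power2_le_imp_le) (use \<open>e > 0\<close> in simp)
    have "expectation (\<lambda>w. \<bar>?G w\<bar>) \<le> expectation (\<lambda>w. \<bar>H w\<bar> + e / 2)"
    proof (intro expectation_mono_bm bm_abs bm_add bm_const bmG bmH)
      show "\<bar>?G w\<bar> \<le> \<bar>H w\<bar> + e / 2" for w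
        using GH[of w] by linarith
    qed
    also have "\<dots> = expectation (\<lambda>w. \<bar>H w\<bar>) + e / 2"
      using integrable_bm[OF bm_abs[OF bmH]] prob_space by simp
    also have "\<dots> \<le> e" using EH by linarith
    finally show ?case unfolding a_def .
  qed
qed

section \<open>Approximating the recurrence averages\<close>

text \<open>The constant is the integral of \<open>k * f\<close>, which depends on \<open>e\<close>
  but not on \<open>N\<close>. The loss \<open>2 * e\<close> arises when \<open>f\<close> is
  replaced by \<open>h\<close> and then \<open>h\<close> by \<open>k\<close> in this integral. The
  error \<open>5 * e\<close> consists of four replacements inside the average and the term left out
  at \<open>u = 0\<close>.\<close>

lemma recurrence_approximation:
  assumes F: "double_Folner_sequence F" and inf: "infinite (UNIV :: 'k set)"
    and f: "f \<in> bm M" "range f \<subseteq> {0..1}" and "e > 0"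
  obtains c where "(expectation f)\<^sup>2 - 2 * e \<le> c"
    "\<forall>\<^sub>F N in sequentially. \<bar>expectation (\<lambda>w. avg (F N)
        (\<lambda>u. if u = 0 then 0 else f (act (1 / u) u w)) * f w) - c\<bar> \<le> 5 * e"
proof -
  have shifts_meas: "shifts \<subseteq> measurable M M" and dil_meas: "dilations \<subseteq> measurable M M"
    using shifts_preserving dilations_preserving by (auto simp: measure_preserving_map_def)
  obtain h where h: "h \<in> orbit_hull shifts f"
      "\<And>t. t \<in> shifts \<Longrightarrow> expectation (\<lambda>w. \<bar>h (t w) - h w\<bar>) \<le> e"
    using almost_invariant_exists[OF f(1) shifts_preserving \<open>e > 0\<close>] by blast
  have hb: "h \<in> bm M" and h01: "range h \<subseteq> {0..1}"
    using orbit_hull_bm[OF h(1) f(1) shifts_meas] orbit_hull_range[OF h(1) f(2)] .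
  obtain k where k: "k \<in> orbit_hull dilations h"
      "\<And>t. t \<in> dilations \<Longrightarrow> expectation (\<lambda>w. \<bar>k (t w) - k w\<bar>) \<le> e"
    using almost_invariant_exists[OF hb dilations_preserving \<open>e > 0\<close>] by blast
  have kb: "k \<in> bm M" and k01: "range k \<subseteq> {0..1}"
    using orbit_hull_bm[OF k(1) hb dil_meas] orbit_hull_range[OF k(1) h01] .
  have r: "0 \<le> f w" "f w \<le> 1" "0 \<le> h w" "h w \<le> 1" "0 \<le> k w" "k w \<le> 1" for w
    using f(2) h01 k01 by (auto simp: image_subset_iff)
  then have f1: "\<bar>f w\<bar> \<le> 1" and h1: "\<bar>h w\<bar> \<le> 1" for w
    by simp_all
  have fh1: "\<bar>f w - h w\<bar> \<le> 1" for w
    using r[of w] by linarith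
  define c where "c = expectation (\<lambda>w. k w * f w)"
  have "\<bar>expectation (\<lambda>w. k w * h w) - c\<bar> \<le> e"
    unfolding c_def by (rule orbit_hull_pairing_id[OF f(1) f1 kb disjI1[OF refl] _ h(1)])
      (rule dilation_hull_invariant[OF k(1) hb h(2)])
  moreover have "\<bar>expectation (\<lambda>w. k w * k w) - expectation (\<lambda>w. k w * h w)\<bar> \<le> e"
    by (rule orbit_hull_pairing_id[OF hb h1 kb disjI2[OF refl] k(2) k(1)])
  moreover have "(expectation f)\<^sup>2 \<le> expectation (\<lambda>w. k w * k w)"
    using square_expectation_le[OF kb] orbit_hull_expectation[OF k(1) hb dilations_preserving]
      orbit_hull_expectation[OF h(1) f(1) shifts_preserving]
    by (simp add: power2_eq_square)
  ultimately have lower: "(expectation f)\<^sup>2 - 2 * e \<le> c"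
    by linarith
  define g where "g w = f w - h w" for w
  have gb: "g \<in> bm M" and g1: "\<And>w. \<bar>g w\<bar> \<le> 1"
    unfolding g_def using f(1) hb fh1 by (auto intro: bm_diff)
  have "\<bar>c\<bar> \<le> 1"
    unfolding c_def using r by (intro abs_expectation_bound bm_mult kb f(1)) (simp add: abs_mult mult_le_one)
  define D where "D N = expectation (\<lambda>w. avg (F N)
        (\<lambda>u. if u = 0 then 0 else f (act (1 / u) u w)) * f w)" for N
  have ev1: "\<forall>\<^sub>F N in sequentially.
      expectation (\<lambda>w. \<bar>avg (F N) (\<lambda>u. if u = 0 then 0 else g (act (1 / u) u w))\<bar>) \<le> e"
    by (rule van_der_Corput[OF F inf gb g1 _ \<open>e > 0\<close>])
      (unfold g_def, rule shift_hull_average[OF F h(1) f(2)])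
  have "\<forall>\<^sub>F N in sequentially. \<bar>D N - c\<bar> \<le> 5 * e"
    using ev1 dilation_hull_average[OF F k(1) h01 \<open>e > 0\<close>] Folner_point[OF F inf \<open>e > 0\<close>]
  proof eventually_elim
    case (elim N)
    let ?A = "\<lambda>\<phi> w. avg (F N) (\<lambda>u. if u = 0 then 0 else \<phi> u w)"
    \<comment> \<open>For \<open>u \<noteq> 0\<close> the four differences telescope from
      \<open>f (act (1 / u) u w)\<close> to \<open>k w\<close>. They are small on average by, in
      turn, van der Corput, almost shift invariance of \<open>h\<close>, multiplicative averaging,
      and almost dilation invariance of \<open>k\<close>.\<close>
    let ?p1 = "\<lambda>u w. g (act (1 / u) u w)"
    let ?p2 = "\<lambda>u w. h (act (1 / u) u w) - h (act (1 / u) 0 w)"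
    let ?p3 = "\<lambda>u w. h (act (1 / u) 0 w) - k (act (1 / u) 0 w)"
    let ?p4 = "\<lambda>u w. k (act (1 / u) 0 w) - k w"
    let ?i = "avg (F N) (indicator {0})"
    have p: "\<And>u. u \<noteq> 0 \<Longrightarrow> ?p1 u \<in> bm M" "\<And>u. u \<noteq> 0 \<Longrightarrow> ?p2 u \<in> bm M"
      "\<And>u. u \<noteq> 0 \<Longrightarrow> ?p3 u \<in> bm M" "\<And>u. u \<noteq> 0 \<Longrightarrow> ?p4 u \<in> bm M"
      using gb hb kb by (intro bm_diff bm_act; simp)+
    have A: "?A \<phi> \<in> bm M" if "\<And>u. u \<noteq> 0 \<Longrightarrow> \<phi> u \<in> bm M" for \<phi>
      using that by (intro bm_avg bm_if)
    have A_small: "expectation (\<lambda>w. \<bar>?A \<phi> w\<bar>) \<le> e"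
      if \<phi>: "\<And>u. u \<noteq> 0 \<Longrightarrow> \<phi> u \<in> bm M" "\<And>u. u \<noteq> 0 \<Longrightarrow> expectation (\<lambda>w. \<bar>\<phi> u w\<bar>) \<le> e" for \<phi>
    proof -
      have "expectation (\<lambda>w. \<bar>?A \<phi> w\<bar>) \<le> expectation (\<lambda>w. avg (F N) (\<lambda>u. \<bar>if u = 0 then 0 else \<phi> u w\<bar>))"
        using \<phi>(1) by (intro expectation_mono_bm bm_abs bm_avg bm_if avg_abs_le)
      also have "\<dots> = avg (F N) (\<lambda>u. expectation (\<lambda>w. \<bar>if u = 0 then 0 else \<phi> u w\<bar>))"
        using \<phi>(1) by (intro expectation_avg bm_abs bm_if)
      also have "\<dots> \<le> avg (F N) (\<lambda>u. e)"
      proof (rule avg_mono)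
        show "expectation (\<lambda>w. \<bar>if u = 0 then 0 else \<phi> u w\<bar>) \<le> e" for u
          using \<phi>(2)[of u] \<open>e > 0\<close> by (cases "u = 0") simp_all
      qed
      also have "\<dots> \<le> e"
        using \<open>e > 0\<close> by (intro avg_const_le) simp
      finally show ?thesis .
    qed
    have E1: "expectation (\<lambda>w. \<bar>?A ?p1 w\<bar>) \<le> e"
      by (rule elim(1))
    have E2: "expectation (\<lambda>w. \<bar>?A ?p2 w\<bar>) \<le> e"
    proof (rule A_small[OF p(2)])
      fix u :: 'k assume u: "u \<noteq> 0"
      let ?d = "\<lambda>w. \<bar>h (act 1 u w) - h w\<bar>"
      \<comment> \<open>The map \<open>x \<mapsto> x / u + u\<close> is the dilation by
        \<open>1 / u\<close> followed by the shift by \<open>u\<close>, so only the shift has to be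
        compared with the identity.\<close>
      have "expectation (\<lambda>w. \<bar>?p2 u w\<bar>) = expectation (\<lambda>w. ?d (act (1 / u) 0 w))"
        by (rule Bochner_Integration.integral_cong[OF refl]) (use u in \<open>simp add: act_act\<close>)
      also have "\<dots> = expectation ?d"
        using u hb by (intro expectation_preserving[of "act (1 / u) 0" ?d] act_preserving bm_abs bm_diff bm_act) auto
      also have "\<dots> \<le> e"
        using h(2)[of "act 1 u"] by (simp add: shifts_def)
      finally show "expectation (\<lambda>w. \<bar>?p2 u w\<bar>) \<le> e" .
    qed
    have E3: "expectation (\<lambda>w. \<bar>?A ?p3 w\<bar>) \<le> e"
      using elim(2) by (intro expectation_le bm_abs A p(3)) auto
    have E4: "expectation (\<lambda>w. \<bar>?A ?p4 w\<bar>) \<le> e"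
    proof (rule A_small[OF p(4)])
      fix u :: 'k assume "u \<noteq> 0"
      then show "expectation (\<lambda>w. \<bar>?p4 u w\<bar>) \<le> e"
        using k(2)[of "act (1 / u) 0"] by (simp add: dilations_def)
    qed
    have F1: "avg (F N) (\<lambda>u. 1) = 1"
      using F by (simp add: avg_def double_Folner_sequence_def)
    \<comment> \<open>The punctured average of the constant \<open>k w\<close> falls short of
      \<open>k w\<close> by \<open>?i * k w\<close>, whence the last term.\<close>
    have "?A (\<lambda>u w. f (act (1 / u) u w)) w * f w - k w * f w =
        ?A ?p1 w * f w + ?A ?p2 w * f w + ?A ?p3 w * f w + ?A ?p4 w * f w - ?i * (k w * f w)" for w
    proof -
      have "k w = avg (F N) (\<lambda>u. k w * 1)"
        unfolding avg_cmult F1 by simp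
      then have "?A (\<lambda>u w. f (act (1 / u) u w)) w - k w =
          ?A (\<lambda>u w. f (act (1 / u) u w)) w - avg (F N) (\<lambda>u. k w * 1)"
        by simp
      also have "\<dots> = ?A ?p1 w + ?A ?p2 w + ?A ?p3 w + ?A ?p4 w - k w * ?i"
        unfolding avg_add[symmetric] avg_diff[symmetric] avg_cmult[symmetric]
        by (intro avg_cong) (auto simp: g_def)
      finally have "?A (\<lambda>u w. f (act (1 / u) u w)) w - k w
          = ?A ?p1 w + ?A ?p2 w + ?A ?p3 w + ?A ?p4 w - k w * ?i" .
      then have "(?A (\<lambda>u w. f (act (1 / u) u w)) w - k w) * f w
          = (?A ?p1 w + ?A ?p2 w + ?A ?p3 w + ?A ?p4 w - k w * ?i) * f w"
        by simp
      then show ?thesis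
        by (simp only: left_diff_distrib distrib_right mult.commute[of "k w" ?i] mult.assoc)
    qed
    note pointwise = this
    have bf: "(\<lambda>w. ?A \<phi> w * f w) \<in> bm M" if "\<And>u. u \<noteq> 0 \<Longrightarrow> \<phi> u \<in> bm M" for \<phi>
      using that by (intro bm_mult A f(1))
    have fu: "(\<lambda>w. f (act (1 / u) u w)) \<in> bm M" if "u \<noteq> 0" for u
      using that f(1) by (intro bm_act) auto
    have small: "\<bar>expectation (\<lambda>w. ?A \<phi> w * f w)\<bar> \<le> e"
      if "\<And>u. u \<noteq> 0 \<Longrightarrow> \<phi> u \<in> bm M" "expectation (\<lambda>w. \<bar>?A \<phi> w\<bar>) \<le> e" for \<phi>
      by (rule order_trans[OF abs_expectation_mult_le[OF A[OF that(1)] f(1) f1] that(2)])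
    have kf: "(\<lambda>w. k w * f w) \<in> bm M"
      by (intro bm_mult kb f(1))
    have combine: "expectation (\<lambda>w. X1 w + X2 w + X3 w + X4 w - ?i * Y w)
        = expectation X1 + expectation X2 + expectation X3 + expectation X4 - ?i * expectation Y"
      if "X1 \<in> bm M" "X2 \<in> bm M" "X3 \<in> bm M" "X4 \<in> bm M" "Y \<in> bm M" for X1 X2 X3 X4 Y
      using that[THEN integrable_bm] by simp
    have "D N - c = expectation (\<lambda>w. ?A (\<lambda>u w. f (act (1 / u) u w)) w * f w - k w * f w)"
      unfolding D_def c_def
      by (rule Bochner_Integration.integral_diff[symmetric])
        (rule integrable_bm[OF bf[OF fu]] integrable_bm[OF kf], assumption?)+
    also have "\<dots> = expectation (\<lambda>w. ?A ?p1 w * f w) + expectation (\<lambda>w. ?A ?p2 w * f w)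
        + expectation (\<lambda>w. ?A ?p3 w * f w) + expectation (\<lambda>w. ?A ?p4 w * f w) - ?i * c"
      unfolding pointwise c_def by (intro combine bf p kf)
    finally have eq: "D N - c = \<dots>" .
    have "0 \<le> ?i"
      by (simp add: avg_def sum_nonneg)
    then have "\<bar>?i * c\<bar> \<le> e * 1"
      unfolding abs_mult using elim(3) \<open>\<bar>c\<bar> \<le> 1\<close> by (intro mult_mono) auto
    with small[OF p(1) E1] small[OF p(2) E2] small[OF p(3) E3] small[OF p(4) E4]
    show ?case
      unfolding eq by linarith
  qed
  with lower show thesis
    by (intro that[of c]) (auto simp: D_def)
qed

text \<open>Membership in the two sets means \<open>act 1 u w \<in> B\<close> and
  \<open>act u 0 w \<in> B\<close>. Substituting \<open>act (1 / u) 0 w\<close> for \<open>w\<close>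
  frees the second condition of \<open>u\<close> and turns the first map into
  \<open>act (1 / u) u\<close>.\<close>

lemma measure_recurrence:
  assumes B: "B \<in> sets M" and "u \<noteq> 0"
  shows "measure M (shift_set T (- u) B \<inter> dilate_set T (1 / u) B)
       = expectation (\<lambda>w. indicator B (act (1 / u) u w) * indicator B w)"
proof -
  let ?f = "indicator B :: 'w \<Rightarrow> real"
  have f: "?f \<in> bm M"
    using B by (intro bmI[of _ _ 1]) (auto simp: indicator_def)
  have BM: "B \<subseteq> space M"
    using B sets.sets_into_space by blast
  have "shift_set T (- u) B = act 1 (- u) ` B" "dilate_set T (1 / u) B = act (1 / u) 0 ` B"
    by (simp_all add: shift_set_def dilate_set_def act_def)
  then have S: "shift_set T (- u) B \<inter> dilate_set T (1 / u) B
      = {w \<in> space M. act 1 u w \<in> B \<and> act u 0 w \<in> B}"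
    using act_image[OF _ BM, of 1 "- u"] act_image[OF _ BM, of "1 / u" 0] \<open>u \<noteq> 0\<close> by auto
  let ?h = "\<lambda>w. ?f (act 1 u w) * ?f (act u 0 w)"
  have h: "?h \<in> bm M"
    using \<open>u \<noteq> 0\<close> f by (intro bm_mult bm_act) auto
  let ?S = "shift_set T (- u) B \<inter> dilate_set T (1 / u) B"
  have "?S \<subseteq> space M"
    unfolding S by auto
  then have "measure M ?S = expectation (indicator ?S)"
    by (simp add: Int_absorb2)
  also have "\<dots> = expectation ?h"
    by (rule Bochner_Integration.integral_cong) (auto simp: S indicator_def)
  also have "\<dots> = expectation (\<lambda>w. ?h (act (1 / u) 0 w))"
    by (rule expectation_preserving[OF act_preserving h, symmetric]) (use \<open>u \<noteq> 0\<close> in simp)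
  also have "\<dots> = expectation (\<lambda>w. ?f (act (1 / u) u w) * ?f w)"
    by (rule Bochner_Integration.integral_cong) (use \<open>u \<noteq> 0\<close> in \<open>simp_all add: act_act act_one\<close>)
  finally show ?thesis .
qed

end

section \<open>Convergence of the averages and the lower bound\<close>

theorem theorem2p6:
  fixes M :: "'w measure"
    and T :: "('k::field \<Rightarrow> 'k) \<Rightarrow> 'w \<Rightarrow> 'w"
    and F :: "nat \<Rightarrow> 'k set"
    and B :: "'w set"
  assumes "countable (UNIV :: 'k set)" and "infinite (UNIV :: 'k set)"
    and "prob_space M"
    and "measure_preserving_action affine_group M T"
    and "double_Folner_sequence F"
    and "B \<in> sets M"
  shows "\<exists>L. (\<lambda>N. 1 / real (card (F N)) *
               (\<Sum>u \<in> F N - {0}. measure M (shift_set T (- u) B \<inter> dilate_set T (1 / u) B)))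
             \<longlonglongrightarrow> L
           \<and> (measure M B)\<^sup>2 \<le> L"
proof -
  interpret prob_space M by fact
  interpret affine_action M T
    by unfold_locales fact
  let ?f = "indicator B :: 'w \<Rightarrow> real"
  define D where "D N = expectation (\<lambda>w. avg (F N)
        (\<lambda>u. if u = 0 then 0 else ?f (act (1 / u) u w)) * ?f w)" for N
  have f: "?f \<in> bm M" "range ?f \<subseteq> {0..1}"
    using \<open>B \<in> sets M\<close> by (auto intro!: bmI[of _ _ 1] simp: indicator_def)
  have Ef: "expectation ?f = measure M B"
    using \<open>B \<in> sets M\<close> sets.sets_into_space by (simp add: Int_absorb2)
  have approx: "\<exists>c \<ge> (measure M B)\<^sup>2 - 2 * e. \<forall>\<^sub>F N in sequentially. \<bar>D N - c\<bar> \<le> 5 * e"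
    if e: "e > 0" for e
  proof -
    obtain c where "(expectation ?f)\<^sup>2 - 2 * e \<le> c"
        "\<forall>\<^sub>F N in sequentially. \<bar>D N - c\<bar> \<le> 5 * e"
      unfolding D_def by (rule recurrence_approximation[OF assms(5,2) f e])
    then show ?thesis unfolding Ef by blast
  qed
  \<comment> \<open>The sum omits \<open>u = 0\<close> but is divided by the full
    \<open>card (F N)\<close>; the integrand of \<open>D\<close> has the value \<open>0\<close>
    there, so both agree.\<close>
  have D: "1 / real (card (F N)) *
      (\<Sum>u \<in> F N - {0}. measure M (shift_set T (- u) B \<inter> dilate_set T (1 / u) B)) = D N" for N
  proof -
    let ?p = "\<lambda>u w. (if u = 0 then 0 else ?f (act (1 / u) u w)) * ?f w"
    have p: "?p u \<in> bm M" for u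
      using f(1) by (intro bm_mult bm_if bm_act) auto
    have "D N = expectation (\<lambda>w. avg (F N) (\<lambda>u. ?p u w))"
      unfolding D_def avg_multc ..
    also have "\<dots> = avg (F N) (\<lambda>u. expectation (?p u))"
      by (rule expectation_avg) (rule p)
    also have "\<dots> = avg (F N) (\<lambda>u. if u = 0 then 0
        else measure M (shift_set T (- u) B \<inter> dilate_set T (1 / u) B))"
      using measure_recurrence[OF \<open>B \<in> sets M\<close>] by (intro avg_cong) simp
    also have "\<dots> = 1 / real (card (F N)) *
      (\<Sum>u \<in> F N - {0}. measure M (shift_set T (- u) B \<inter> dilate_set T (1 / u) B))"
    proof -
      have "finite (F N)"
        using assms(5) by (simp add: double_Folner_sequence_def)
      then have "(\<Sum>u\<in>F N. if u = 0 then 0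
          else measure M (shift_set T (- u) B \<inter> dilate_set T (1 / u) B))
        = (\<Sum>u \<in> F N - {0}. measure M (shift_set T (- u) B \<inter> dilate_set T (1 / u) B))"
        by (intro sum.mono_neutral_cong_right) auto
      then show ?thesis by (simp add: avg_def)
    qed
    finally show ?thesis ..
  qed
  \<comment> \<open>The constants from \<open>approx\<close> vary with \<open>e\<close>, so no limit
    is at hand; being eventually close to some constant for every \<open>e\<close> suffices for a
    Cauchy sequence.\<close>
  have "Cauchy D"
  proof (rule metric_CauchyI)
    fix r :: real assume "r > 0"
    \<comment> \<open>Two values within \<open>5 * (r / 11)\<close> of \<open>c\<close> differ by at
      most \<open>10 * r / 11\<close>, which is less than \<open>r\<close>.\<close>
    then obtain c where "\<forall>\<^sub>F N in sequentially. \<bar>D N - c\<bar> \<le> 5 * (r / 11)"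
      using approx[of "r / 11"] by auto
    then obtain n where n: "\<And>N. N \<ge> n \<Longrightarrow> \<bar>D N - c\<bar> \<le> 5 * (r / 11)"
      unfolding eventually_sequentially by blast
    show "\<exists>n. \<forall>i\<ge>n. \<forall>j\<ge>n. dist (D i) (D j) < r"
    proof (intro exI allI impI)
      fix i j assume "n \<le> i" "n \<le> j"
      then show "dist (D i) (D j) < r"
        using n[of i] n[of j] \<open>r > 0\<close> unfolding dist_real_def by linarith
    qed
  qed
  then obtain L where L: "D \<longlonglongrightarrow> L"
    using Cauchy_convergent convergent_def by blast
  have "(measure M B)\<^sup>2 \<le> L"
  proof (rule field_le_epsilon)
    fix r :: real assume "r > 0"
    \<comment> \<open>The lower bound on \<open>c\<close> loses \<open>2 * (r / 7)\<close> and the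
      distance of \<open>D N\<close> from \<open>c\<close> another \<open>5 * (r / 7)\<close>, which
      add up to \<open>r\<close>.\<close>
    then obtain c where c: "(measure M B)\<^sup>2 - 2 * (r / 7) \<le> c"
        "\<forall>\<^sub>F N in sequentially. \<bar>D N - c\<bar> \<le> 5 * (r / 7)"
      using approx[of "r / 7"] by auto
    have "\<forall>\<^sub>F N in sequentially. (measure M B)\<^sup>2 - r \<le> D N"
      using c(2) by eventually_elim (use c(1) in linarith)
    then have "(measure M B)\<^sup>2 - r \<le> L"
      by (rule tendsto_lowerbound[OF L]) simp
    then show "(measure M B)\<^sup>2 \<le> L + r" by linarith
  qed
  with L show ?thesis
    unfolding D by blast
qed

end
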